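(* Let $F(t)$ be the fundamental endomorphism of a fanning frame $A(t)$ in $\mathbb{R}^{kn}$. At each value of $t$, $D(t)=\frac1k\left(2\dot F(t)-(k-2)I\right)$ is a reflection (i.e. $D(t)^2=I$) whose $-1$ eigenspace is the vertical space $v(t)$.
   Context: Let $n\ge1$, $k\ge2$ be integers. A frame is a smooth curve $A(t)$ of real $kn\times n$ matrices; it is fanning if the $kn\times kn$ matrix $(A(t)|\dot A(t)|\cdots|A^{(k-1)}(t))$ is invertible for all $t$. The fundamental endomorphism $F(t):\mathbb{R}^{kn}\to\mathbb{R}^{kn}$ of $A(t)$ is the linear map defined by $F(t)A(t)=0$ and $F(t)A^{(i)}(t)=i\,A^{(i-1)}(t)$ for $1\le i\le k-1$. The vertical space is $v(t)=\mathrm{Span}\{A(t),\dot A(t),\dots,A^{(k-2)}(t)\}$ (the span of all the columns). *)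

theory Defs
  imports "HOL-Analysis.Analysis"
begin

text \<open>
  Throughout, \<open>k = CARD('k)\<close> and \<open>n = CARD('n)\<close>, and the \<open>k n\<close> coordinates are indexed by
  \<open>'k \<times> 'n\<close>. The type \<open>'k\<close> is linearly ordered only in order to number the
  \<open>k\<close> blocks of columns by \<open>0, \<dots>, k - 1\<close>.
\<close>

definition nth_vector_derivative :: "nat \<Rightarrow> (real \<Rightarrow> 'a::real_normed_vector) \<Rightarrow> real \<Rightarrow> 'a"
  where "nth_vector_derivative i f = ((\<lambda>g t. vector_derivative g (at t)) ^^ i) f"

text \<open>Two-sided derivatives are used, so this is only meant for open \<open>I\<close>.\<close>

definition smooth_curve_on :: "real set \<Rightarrow> (real \<Rightarrow> 'a::real_normed_vector) \<Rightarrow> bool"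
  where "smooth_curve_on I f \<longleftrightarrow>
    (\<forall>i. \<forall>t\<in>I. nth_vector_derivative i f differentiable (at t))"

definition block_number :: "'k::{finite,linorder} \<Rightarrow> nat"
  where "block_number j = card {..<j}"

text \<open>The square matrix \<open>(A(t) | A'(t) | \<dots> | A^(k-1)(t))\<close>: its column with index \<open>(j, c)\<close> is
  column \<open>c\<close> of the derivative of \<open>A\<close> of order \<open>block_number j\<close>.\<close>

definition jet_matrix ::
  "(real \<Rightarrow> real^'n::finite^('k::{finite,linorder} \<times> 'n)) \<Rightarrow> real \<Rightarrow> real^('k \<times> 'n)^('k \<times> 'n)"
  where "jet_matrix A t =
    (\<chi> r p. nth_vector_derivative (block_number (fst p)) A t $ r $ snd p)"

definition fanning_frame_on ::
  "real set \<Rightarrow> (real \<Rightarrow> real^'n::finite^('k::{finite,linorder} \<times> 'n)) \<Rightarrow> bool"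
  where "fanning_frame_on I A \<longleftrightarrow>
    smooth_curve_on I A \<and> (\<forall>t\<in>I. invertible (jet_matrix A t))"

text \<open>Linear endomorphisms are identified with their matrices in the standard basis.\<close>

definition fundamental_endomorphism ::
  "(real \<Rightarrow> real^'n::finite^('k::{finite,linorder} \<times> 'n)) \<Rightarrow> real \<Rightarrow> real^('k \<times> 'n)^('k \<times> 'n)"
  where "fundamental_endomorphism A t = (THE F.
    F ** A t = 0 \<and>
    (\<forall>i\<in>{1..CARD('k) - 1}.
      F ** nth_vector_derivative i A t = real i *\<^sub>R nth_vector_derivative (i - 1) A t))"

definition vertical_space ::
  "(real \<Rightarrow> real^'n::finite^('k::{finite,linorder} \<times> 'n)) \<Rightarrow> real \<Rightarrow> (real^('k \<times> 'n)) set"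
  where "vertical_space A t =
    span (\<Union>i\<in>{0..CARD('k) - 2}. columns (nth_vector_derivative i A t))"

definition eigenspace :: "real^'m::finite^'m \<Rightarrow> real \<Rightarrow> (real^'m) set"
  where "eigenspace M c = {x. M *v x = c *\<^sub>R x}"

end

theory Submission
  imports Defs
begin

text \<open>
  Write \<open>A\<^sub>i\<close> for the \<open>i\<close>-th derivative of the frame. Since \<open>(A\<^sub>0 | \<dots> | A\<^bsub>k-1\<^esub>)\<close> is invertible,
  an endomorphism is determined by its products with the blocks \<open>A\<^sub>0, \<dots>, A\<^bsub>k-1\<^esub>\<close>, and these can
  be prescribed at will (\<open>matrix_eq_on_blocks\<close>, \<open>matrix_with_prescribed_blocks\<close>). In particular
  \<open>F\<close> is well defined, and Cramer's rule shows that it is differentiable in \<open>t\<close>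
  (\<open>fundamental_endomorphism_differentiable\<close>).

  Differentiating \<open>F A\<^sub>i = i A\<^bsub>i-1\<^esub>\<close> gives \<open>F' A\<^sub>i = i A\<^sub>i - F A\<^bsub>i+1\<^esub>\<close> for all \<open>i < k\<close>
  (\<open>fundamental_endomorphism_derivative_mult_block\<close>). For
  \<open>i \<le> k - 2\<close> the right-hand side is \<open>i A\<^sub>i - (i + 1) A\<^sub>i = - A\<^sub>i\<close>, hence \<open>D A\<^sub>i = - A\<^sub>i\<close>. For
  \<open>i = k - 1\<close> it yields \<open>D A\<^bsub>k-1\<^esub> = A\<^bsub>k-1\<^esub> - (2/k) F A\<^sub>k\<close>. As \<open>F\<close> takes its values in the
  vertical space, \<open>D\<close> is \<open>-1\<close> on \<open>v\<close> and the identity modulo \<open>v\<close>. A map of this kind is an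
  involution, because \<open>D\<close> changes the sign of the correction term \<open>(2/k) F A\<^sub>k\<close>. If moreover
  \<open>D x = - x\<close>, then \<open>x = - (D - I) x / 2\<close> lies in \<open>v\<close>, because \<open>D - I\<close> has values in \<open>v\<close>.
\<close>

section \<open>Matrix products and differentiability\<close>

lemma bounded_bilinear_matrix_mult:
  "bounded_bilinear ((**) :: real^'m^'l \<Rightarrow> real^'n^'m \<Rightarrow> real^'n^'l)"
proof -
  have "bilinear ((**) :: real^'m^'l \<Rightarrow> real^'n^'m \<Rightarrow> real^'n^'l)"
    unfolding bilinear_def linear_iff
    by (simp add: matrix_matrix_mult_def vec_eq_iff algebra_simps sum.distrib sum_distrib_left)
  then show ?thesis
    by (simp add: bilinear_conv_bounded_bilinear)
qed

lemma matrix_diff_mult: "((A::real^'m^'l) - B) ** C = A ** C - B ** C"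
  by (rule bounded_bilinear.diff_left[OF bounded_bilinear_matrix_mult])

lemma matrix_mult_diff: "(A::real^'m^'l) ** (B - C) = A ** B - A ** C"
  by (rule bounded_bilinear.diff_right[OF bounded_bilinear_matrix_mult])

lemma matrix_scaleR_mult: "(c *\<^sub>R (A::real^'m^'l)) ** B = c *\<^sub>R (A ** B)"
  by (rule bounded_bilinear.scaleR_left[OF bounded_bilinear_matrix_mult])

lemma matrix_mult_scaleR: "(A::real^'m^'l) ** (c *\<^sub>R B) = c *\<^sub>R (A ** B)"
  by (rule bounded_bilinear.scaleR_right[OF bounded_bilinear_matrix_mult])

lemma differentiable_vec_nth:
  "f differentiable (at t) \<Longrightarrow> (\<lambda>s. f s $ i) differentiable (at t)"
  unfolding differentiable_def
  using bounded_linear.has_derivative[OF bounded_linear_vec_nth] by blast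

lemma differentiable_matrix_componentwise:
  fixes M :: "real \<Rightarrow> real^'n^'m"
  assumes "\<And>r c. (\<lambda>s. M s $ r $ c) differentiable (at t)"
  shows "M differentiable (at t)"
  unfolding differentiable_componentwise_within[of M]
  using assms by (auto simp: Basis_vec_def inner_axis)

lemma differentiable_prod:
  fixes f :: "'i \<Rightarrow> real \<Rightarrow> real"
  assumes "\<And>i. i \<in> S \<Longrightarrow> f i differentiable (at t)"
  shows "(\<lambda>s. \<Prod>i\<in>S. f i s) differentiable (at t)"
proof -
  obtain f' where "\<And>i. i \<in> S \<Longrightarrow> (f i has_derivative f' i) (at t)"
    using assms unfolding differentiable_def by metis
  then show ?thesis
    unfolding differentiable_def using has_derivative_prod[of S f f' t UNIV] by blast
qed

lemma differentiable_det:
  fixes M :: "real \<Rightarrow> real^'n^'n"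
  assumes "\<And>i j. (\<lambda>s. M s $ i $ j) differentiable (at t)"
  shows "(\<lambda>s. det (M s)) differentiable (at t)"
  unfolding det_def
  by (intro differentiable_sum ballI differentiable_mult differentiable_const
      differentiable_prod assms finite_permutations finite_class.finite_UNIV)

text \<open>By Cramer's rule, applied to the transposed equation row by row, the entries of the
  solution of \<open>F J = K\<close> are quotients of determinants in the entries of \<open>J\<close> and \<open>K\<close>.\<close>

lemma differentiable_matrix_right_quotient:
  fixes F :: "real \<Rightarrow> real^'n^'m" and J :: "real \<Rightarrow> real^'n^'n" and K :: "real \<Rightarrow> real^'n^'m"
  assumes "open I" "t \<in> I"
    and inv: "\<And>s. s \<in> I \<Longrightarrow> invertible (J s)"
    and eq: "\<And>s. s \<in> I \<Longrightarrow> F s ** J s = K s"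
    and J: "\<And>i j. (\<lambda>s. J s $ i $ j) differentiable (at t)"
    and K: "\<And>i j. (\<lambda>s. K s $ i $ j) differentiable (at t)"
  shows "F differentiable (at t)"
proof (rule differentiable_matrix_componentwise)
  fix r c
  define N where "N s = (\<chi> i j. if j = c then K s $ r $ i else J s $ j $ i)" for s
  have det0: "det (J s) \<noteq> 0" if "s \<in> I" for s
    using inv[OF that] by (simp add: invertible_det_nz)
  have F_eq: "det (N s) / det (J s) = F s $ r $ c" if "s \<in> I" for s
  proof -
    have "transpose (J s) *v (F s $ r) = K s $ r"
      unfolding eq[OF that, symmetric]
      by (simp add: vec_eq_iff matrix_vector_mult_def matrix_matrix_mult_def transpose_def
          mult.commute)
    then have "F s $ r = (\<chi> l. det (\<chi> i j. if j = l then K s $ r $ i else transpose (J s) $ i $ j)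
        / det (transpose (J s)))"
      using cramer[of "transpose (J s)" "F s $ r" "K s $ r"] det0[OF that] by simp
    moreover have "N s = (\<chi> i j. if j = c then K s $ r $ i else transpose (J s) $ i $ j)"
      by (simp add: N_def transpose_def vec_eq_iff)
    ultimately show ?thesis
      by simp
  qed
  have "(\<lambda>s. N s $ i $ j) differentiable (at t)" for i j
    by (cases "j = c") (simp_all add: N_def J K)
  then have "(\<lambda>s. det (N s) / det (J s)) differentiable (at t)"
    using J det0[OF \<open>t \<in> I\<close>] by (intro differentiable_divide differentiable_det) auto
  then obtain d where "((\<lambda>s. det (N s) / det (J s)) has_derivative d) (at t)"
    unfolding differentiable_def by blast
  from has_derivative_transform_within_open[OF this \<open>open I\<close> \<open>t \<in> I\<close> F_eq]
  show "(\<lambda>s. F s $ r $ c) differentiable (at t)"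
    unfolding differentiable_def by blast
qed

section \<open>Endomorphisms in terms of the blocks of the jet matrix\<close>

lemma bij_betw_block_number:
  "bij_betw (block_number :: 'k::{finite,linorder} \<Rightarrow> nat) UNIV {..<CARD('k)}"
proof -
  have less: "block_number i < block_number j" if "i < j" for i j :: 'k
    unfolding block_number_def using that by (intro psubset_card_mono) auto
  have inj: "inj (block_number :: 'k \<Rightarrow> nat)"
    by (rule injI) (metis less less_irrefl linorder_cases)
  have "block_number j < CARD('k)" for j :: 'k
    unfolding block_number_def by (intro psubset_card_mono) auto
  then have "range (block_number :: 'k \<Rightarrow> nat) = {..<CARD('k)}"
    using inj by (intro card_subset_eq) (auto simp: card_image)
  with inj show ?thesis
    by (simp add: bij_betw_def)
qed

lemma block_number_less: "block_number (j :: 'k::{finite,linorder}) < CARD('k)"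
  using bij_betw_block_number bij_betw_apply by fastforce

lemma block_number_surj:
  assumes "i < CARD('k::{finite,linorder})"
  obtains j :: "'k::{finite,linorder}" where "block_number j = i"
proof -
  have "i \<in> range (block_number :: 'k \<Rightarrow> nat)"
    using assms by (simp add: bij_betw_imp_surj_on[OF bij_betw_block_number])
  then show ?thesis
    using that by (elim rangeE) simp
qed

lemma matrix_mult_jet_matrix_nth:
  fixes A :: "real \<Rightarrow> real^'n::finite^('k::{finite,linorder} \<times> 'n)"
  shows "(M ** jet_matrix A t) $ r $ p =
    (M ** nth_vector_derivative (block_number (fst p)) A t) $ r $ snd p"
  by (simp add: matrix_matrix_mult_def jet_matrix_def)

text \<open>The uniqueness half of the principle that the products with the blocks, which play the part
  of the values on a basis, determine an endomorphism.\<close>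

lemma matrix_eq_on_blocks:
  fixes A :: "real \<Rightarrow> real^'n::finite^('k::{finite,linorder} \<times> 'n)"
    and M N :: "real^('k \<times> 'n)^'m"
  assumes inv: "invertible (jet_matrix A t)"
    and eq: "\<And>i. i < CARD('k) \<Longrightarrow>
      M ** nth_vector_derivative i A t = N ** nth_vector_derivative i A t"
  shows "M = N"
proof -
  obtain B where B: "jet_matrix A t ** B = mat 1"
    using inv unfolding invertible_def by blast
  have "M ** jet_matrix A t = N ** jet_matrix A t"
    by (simp add: vec_eq_iff matrix_mult_jet_matrix_nth eq block_number_less)
  then have "M ** (jet_matrix A t ** B) = N ** (jet_matrix A t ** B)"
    by (simp add: matrix_mul_assoc)
  then show ?thesis
    by (simp add: B)
qed

lemma matrix_with_prescribed_blocks: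
  fixes A :: "real \<Rightarrow> real^'n::finite^('k::{finite,linorder} \<times> 'n)"
    and B :: "nat \<Rightarrow> real^'n^'m"
  assumes inv: "invertible (jet_matrix A t)"
  obtains M :: "real^('k \<times> 'n)^'m"
  where "\<And>i. i < CARD('k) \<Longrightarrow> M ** nth_vector_derivative i A t = B i"
proof -
  define K :: "real^('k \<times> 'n)^'m" where "K = (\<chi> r p. B (block_number (fst p)) $ r $ snd p)"
  obtain C where C: "C ** jet_matrix A t = mat 1"
    using inv unfolding invertible_def by blast
  have MJ: "(K ** C) ** jet_matrix A t = K"
    by (simp add: C flip: matrix_mul_assoc)
  have "(K ** C) ** nth_vector_derivative i A t = B i" if i: "i < CARD('k)" for i
  proof -
    obtain j :: 'k where "block_number j = i"
      using block_number_surj[OF i] .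
    then have "((K ** C) ** nth_vector_derivative i A t) $ r $ c = B i $ r $ c" for r c
      using matrix_mult_jet_matrix_nth[of "K ** C" A t r "(j, c)"] unfolding MJ
      by (simp add: K_def)
    then show ?thesis
      by (simp add: vec_eq_iff)
  qed
  then show ?thesis
    by (rule that)
qed

text \<open>Every vector is a combination of columns of the blocks, so a subspace that contains the
  images of these columns contains the whole range.\<close>

lemma matrix_range_in_subspace:
  fixes A :: "real \<Rightarrow> real^'n::finite^('k::{finite,linorder} \<times> 'n)"
    and M :: "real^('k \<times> 'n)^'m"
  assumes inv: "invertible (jet_matrix A t)"
    and S: "subspace S"
    and cols: "\<And>i. i < CARD('k) \<Longrightarrow> columns (M ** nth_vector_derivative i A t) \<subseteq> S"
  shows "M *v x \<in> S"
proof -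
  obtain B where B: "jet_matrix A t ** B = mat 1"
    using inv unfolding invertible_def by blast
  have "column p (M ** jet_matrix A t) \<in> S" for p
  proof -
    have "column p (M ** jet_matrix A t) =
        column (snd p) (M ** nth_vector_derivative (block_number (fst p)) A t)"
      by (simp add: column_def vec_eq_iff matrix_mult_jet_matrix_nth)
    then show ?thesis
      using cols[OF block_number_less, of "fst p"] by (auto simp: columns_def)
  qed
  then have "(M ** jet_matrix A t) *v (B *v x) \<in> S"
    unfolding matrix_mult_sum scalar_mult_eq_scaleR
    by (intro subspace_sum subspace_scale S)
  then show ?thesis
    by (simp add: matrix_vector_mul_assoc B flip: matrix_mul_assoc)
qed

lemma column_matrix_mult: "column c (M ** N) = M *v column c (N :: real^'n^'m)"
  by (simp add: column_def vec_eq_iff matrix_matrix_mult_def matrix_vector_mult_def)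

lemma column_scaleR: "column c (a *\<^sub>R (N :: real^'n^'m)) = a *\<^sub>R column c N"
  by (simp add: column_def vec_eq_iff)

section \<open>The fundamental endomorphism and its derivative\<close>

lemma fanning_frame_on_jet_invertible:
  "fanning_frame_on I A \<Longrightarrow> t \<in> I \<Longrightarrow> invertible (jet_matrix A t)"
  by (simp add: fanning_frame_on_def)

lemma fanning_frame_on_differentiable:
  "fanning_frame_on I A \<Longrightarrow> t \<in> I \<Longrightarrow> nth_vector_derivative i A differentiable (at t)"
  by (simp add: fanning_frame_on_def smooth_curve_on_def)

lemma fanning_frame_on_has_vector_derivative:
  assumes "fanning_frame_on I A" "t \<in> I"
  shows "(nth_vector_derivative i A has_vector_derivative nth_vector_derivative (Suc i) A t) (at t)"
  using fanning_frame_on_differentiable[OF assms]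
  by (simp add: nth_vector_derivative_def vector_derivative_works)

text \<open>For \<open>i = 0\<close> the formula reads \<open>F A = 0\<close>, since \<open>real 0 = 0\<close>; the truncated difference
  \<open>0 - 1\<close> does no harm.\<close>

lemma fundamental_endomorphism_mult_block:
  fixes A :: "real \<Rightarrow> real^'n::finite^('k::{finite,linorder} \<times> 'n)"
  assumes inv: "invertible (jet_matrix A t)" and i: "i < CARD('k)"
  shows "fundamental_endomorphism A t ** nth_vector_derivative i A t =
    real i *\<^sub>R nth_vector_derivative (i - 1) A t"
proof -
  let ?P = "\<lambda>F :: real^('k \<times> 'n)^('k \<times> 'n). \<forall>i<CARD('k).
    F ** nth_vector_derivative i A t = real i *\<^sub>R nth_vector_derivative (i - 1) A t"
  have split: "(\<forall>i<CARD('k). Q i) \<longleftrightarrow> Q 0 \<and> (\<forall>i\<in>{1..CARD('k) - 1}. Q i)" for Q :: "nat \<Rightarrow> bool"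
  proof -
    have "{..<CARD('k)} = insert 0 {1..CARD('k) - 1}"
      using zero_less_card_finite[where 'a='k] by auto
    then show ?thesis
      by (metis insert_iff lessThan_iff)
  qed
  have F_def: "fundamental_endomorphism A t = (THE F. ?P F)"
    unfolding fundamental_endomorphism_def split by (simp add: nth_vector_derivative_def)
  obtain M where M: "?P M"
    using matrix_with_prescribed_blocks[OF inv,
        of "\<lambda>i. real i *\<^sub>R nth_vector_derivative (i - 1) A t"] by blast
  have "?P (THE F. ?P F)"
  proof (rule theI[of ?P, OF M])
    fix N assume "?P N"
    then show "N = M"
      using M by (intro matrix_eq_on_blocks[OF inv]) simp
  qed
  then show ?thesis
    using i by (simp add: F_def)
qed

lemma fundamental_endomorphism_differentiable:
  fixes A :: "real \<Rightarrow> real^'n::finite^('k::{finite,linorder} \<times> 'n)"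
  assumes "open I" and A: "fanning_frame_on I A" and t: "t \<in> I"
  shows "fundamental_endomorphism A differentiable (at t)"
proof (rule differentiable_matrix_right_quotient[OF \<open>open I\<close> t])
  let ?K = "\<lambda>s. \<chi> r p. real (block_number (fst p)) *
    nth_vector_derivative (block_number (fst p) - 1) A s $ r $ snd p"
  have entry: "(\<lambda>s. nth_vector_derivative i A s $ r $ c) differentiable (at t)" for i r c
    by (intro differentiable_vec_nth fanning_frame_on_differentiable[OF A t])
  show "invertible (jet_matrix A s)" if "s \<in> I" for s
    using A that by (rule fanning_frame_on_jet_invertible)
  show "fundamental_endomorphism A s ** jet_matrix A s = ?K s" if "s \<in> I" for s
    by (simp add: vec_eq_iff matrix_mult_jet_matrix_nth block_number_less
        fundamental_endomorphism_mult_block[OF fanning_frame_on_jet_invertible[OF A that]])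
  show "(\<lambda>s. jet_matrix A s $ i $ j) differentiable (at t)" for i j
    by (simp add: jet_matrix_def entry)
  show "(\<lambda>s. ?K s $ i $ j) differentiable (at t)" for i j
    by (simp add: entry differentiable_mult)
qed

text \<open>The Leibniz rule applied to \<open>F A\<^sub>i = i A\<^bsub>i-1\<^esub>\<close>, an identity that holds on all of \<open>I\<close>. The
  term \<open>F A\<^bsub>i+1\<^esub>\<close> is left as it is, because for \<open>i = k - 1\<close> it involves \<open>A\<^sub>k\<close>, on which the
  definition of \<open>F\<close> gives no formula.\<close>

lemma fundamental_endomorphism_derivative_mult_block:
  fixes A :: "real \<Rightarrow> real^'n::finite^('k::{finite,linorder} \<times> 'n)"
  assumes "open I" and A: "fanning_frame_on I A" and t: "t \<in> I" and i: "i < CARD('k)"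
  shows "vector_derivative (fundamental_endomorphism A) (at t) ** nth_vector_derivative i A t =
    real i *\<^sub>R nth_vector_derivative i A t -
    fundamental_endomorphism A t ** nth_vector_derivative (Suc i) A t"
proof -
  let ?F = "fundamental_endomorphism A" and ?X = "\<lambda>i. nth_vector_derivative i A"
  note X_deriv = fanning_frame_on_has_vector_derivative[OF A t]
  have "(?F has_vector_derivative vector_derivative ?F (at t)) (at t)"
    using fundamental_endomorphism_differentiable[OF \<open>open I\<close> A t]
    by (simp add: vector_derivative_works)
  from bounded_bilinear.has_vector_derivative[OF bounded_bilinear_matrix_mult this X_deriv]
  have "((\<lambda>s. ?F s ** ?X i s) has_vector_derivative
      (?F t ** ?X (Suc i) t + vector_derivative ?F (at t) ** ?X i t)) (at t)" .
  then have "((\<lambda>s. real i *\<^sub>R ?X (i - 1) s) has_vector_derivative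
      (?F t ** ?X (Suc i) t + vector_derivative ?F (at t) ** ?X i t)) (at t)"
    using \<open>open I\<close> t
    by (rule has_vector_derivative_transform_within_open)
      (simp add: fundamental_endomorphism_mult_block[OF fanning_frame_on_jet_invertible[OF A]] i)
  moreover have "((\<lambda>s. real i *\<^sub>R ?X (i - 1) s) has_vector_derivative real i *\<^sub>R ?X i t) (at t)"
    using bounded_linear.has_vector_derivative[OF bounded_linear_scaleR_right X_deriv,
        of "real i" "i - 1"]
    by (cases i) auto
  ultimately have "?F t ** ?X (Suc i) t + vector_derivative ?F (at t) ** ?X i t = real i *\<^sub>R ?X i t"
    by (rule vector_derivative_unique_at)
  then show ?thesis
    by (simp add: algebra_simps)
qed

section \<open>The reflection\<close>

lemma subspace_vertical_space: "subspace (vertical_space A t)"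
  by (simp add: vertical_space_def)

lemma column_in_vertical_space:
  fixes A :: "real \<Rightarrow> real^'n::finite^('k::{finite,linorder} \<times> 'n)"
  assumes "i \<le> CARD('k) - 2"
  shows "column c (nth_vector_derivative i A t) \<in> vertical_space A t"
  unfolding vertical_space_def using assms by (intro span_base) (auto simp: columns_def)

lemma fundamental_endomorphism_in_vertical_space:
  fixes A :: "real \<Rightarrow> real^'n::finite^('k::{finite,linorder} \<times> 'n)"
  assumes inv: "invertible (jet_matrix A t)"
  shows "fundamental_endomorphism A t *v x \<in> vertical_space A t"
  using inv subspace_vertical_space
proof (rule matrix_range_in_subspace)
  fix i assume i: "i < CARD('k)"
  then have "column c (nth_vector_derivative (i - 1) A t) \<in> vertical_space A t" for c
    by (intro column_in_vertical_space) linarith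
  then show "columns (fundamental_endomorphism A t ** nth_vector_derivative i A t)
      \<subseteq> vertical_space A t"
    by (auto simp: columns_def fundamental_endomorphism_mult_block[OF inv i] column_scaleR
        intro: subspace_scale[OF subspace_vertical_space])
qed

lemma subspace_eigenspace: "subspace (eigenspace M c)"
  by (auto simp: eigenspace_def subspace_def matrix_vector_right_distrib scaleR_add_right
      matrix_vector_mult_scaleR scaleR_left_commute)

theorem proposition3p3:
  fixes A :: "real \<Rightarrow> real^'n::finite^('k::{finite,linorder} \<times> 'n)"
    and F D :: "real \<Rightarrow> real^('k \<times> 'n)^('k \<times> 'n)"
    and I :: "real set" and t :: real
  assumes k: "CARD('k) \<ge> 2"
    and I: "open I" "is_interval I"
    and A: "fanning_frame_on I A"
    and t: "t \<in> I"
  defines "F \<equiv> fundamental_endomorphism A"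
    and "D \<equiv> \<lambda>s. (1 / real CARD('k)) *\<^sub>R
      (2 *\<^sub>R vector_derivative F (at s) - (real CARD('k) - 2) *\<^sub>R mat 1)"
  shows "F differentiable (at t) \<and> D t ** D t = mat 1 \<and> eigenspace (D t) (-1) = vertical_space A t"
proof -
  let ?X = "\<lambda>i. nth_vector_derivative i A t"
  let ?S = "vertical_space A t"
  define m where "m = CARD('k) - 1"
  have km: "CARD('k) = Suc m" "real CARD('k) = real m + 1" "m \<ge> 1"
    using k by (auto simp: m_def)
  note inv = fanning_frame_on_jet_invertible[OF A t]
  have F_block: "F t ** ?X i = real i *\<^sub>R ?X (i - 1)" if "i \<le> m" for i
    using that unfolding F_def
    by (intro fundamental_endomorphism_mult_block[OF inv]) (simp add: km)
  have D_mult: "D t ** ?X i = (1 / (real m + 1)) *\<^sub>R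
      (2 *\<^sub>R (real i *\<^sub>R ?X i - F t ** ?X (Suc i)) - (real m - 1) *\<^sub>R ?X i)" if "i \<le> m" for i
    using that fundamental_endomorphism_derivative_mult_block[OF \<open>open I\<close> A t, of i]
    by (simp add: D_def F_def km(1) matrix_scaleR_mult matrix_diff_mult)
  have D_low: "D t ** ?X i = - ?X i" if "i < m" for i
  proof -
    have "D t ** ?X i = (1 / (real m + 1)) *\<^sub>R
        (2 *\<^sub>R (real i *\<^sub>R ?X i - (real i + 1) *\<^sub>R ?X i) - (real m - 1) *\<^sub>R ?X i)"
      using that by (simp add: D_mult F_block add.commute)
    also have "2 *\<^sub>R (real i *\<^sub>R ?X i - (real i + 1) *\<^sub>R ?X i) - (real m - 1) *\<^sub>R ?X i
        = - ((real m + 1) *\<^sub>R ?X i)"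
      by (simp add: vec_eq_iff algebra_simps)
    finally show ?thesis
      by simp
  qed
  have D_top: "D t ** ?X m = ?X m - (2 / (real m + 1)) *\<^sub>R (F t ** ?X (Suc m))"
  proof -
    have "2 *\<^sub>R (real m *\<^sub>R ?X m - F t ** ?X (Suc m)) - (real m - 1) *\<^sub>R ?X m
        = (real m + 1) *\<^sub>R ?X m - 2 *\<^sub>R (F t ** ?X (Suc m))"
      by (simp add: vec_eq_iff algebra_simps)
    then have "D t ** ?X m = (1 / (real m + 1)) *\<^sub>R
        ((real m + 1) *\<^sub>R ?X m - 2 *\<^sub>R (F t ** ?X (Suc m)))"
      by (simp only: D_mult order_refl)
    then show ?thesis
      by (simp add: scaleR_diff_right)
  qed

  \<comment> \<open>\<open>F\<close> maps into the span of \<open>A\<^sub>0, \<dots>, A\<^bsub>k-2\<^esub>\<close>, where \<open>D\<close> is \<open>-1\<close>. This is what makes the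
      correction term in \<open>D_top\<close> cancel in \<open>D\<^sup>2\<close>.\<close>
  have DF: "D t ** F t = - F t"
  proof (rule matrix_eq_on_blocks[OF inv])
    fix i assume "i < CARD('k)"
    then have "i \<le> m"
      by (simp add: km)
    then show "(D t ** F t) ** ?X i = (- F t) ** ?X i"
      by (cases i) (simp_all add: F_block D_low matrix_mult_scaleR
          bounded_bilinear.minus_left[OF bounded_bilinear_matrix_mult] flip: matrix_mul_assoc)
  qed
  have "D t ** D t = mat 1"
  proof (rule matrix_eq_on_blocks[OF inv])
    fix i assume "i < CARD('k)"
    then consider "i < m" | "i = m"
      by (auto simp: km less_Suc_eq)
    then show "(D t ** D t) ** ?X i = mat 1 ** ?X i"
    proof cases
      case 1
      then show ?thesis
        by (simp add: D_low bounded_bilinear.minus_right[OF bounded_bilinear_matrix_mult]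
            flip: matrix_mul_assoc)
    next
      case 2
      have "D t ** (F t ** ?X (Suc m)) = - (F t ** ?X (Suc m))"
        by (simp add: matrix_mul_assoc DF bounded_bilinear.minus_left[OF bounded_bilinear_matrix_mult])
      with 2 show ?thesis
        by (simp add: D_top matrix_mult_diff matrix_mult_scaleR flip: matrix_mul_assoc)
    qed
  qed

  moreover have "eigenspace (D t) (-1) = ?S"
  proof
    \<comment> \<open>A solution of \<open>D x = - x\<close> is \<open>- (D - I) x / 2\<close>, so it suffices to bound the range of
        \<open>D - I\<close>.\<close>
    have "(D t - mat 1) *v x \<in> ?S" for x
      using inv subspace_vertical_space
    proof (rule matrix_range_in_subspace)
      fix i assume "i < CARD('k)"
      then consider "i < m" | "i = m"
        by (auto simp: km less_Suc_eq)
      then show "columns ((D t - mat 1) ** ?X i) \<subseteq> ?S"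
      proof cases
        case 1
        then have "(D t - mat 1) ** ?X i = (-2) *\<^sub>R ?X i"
          by (simp add: matrix_diff_mult D_low scaleR_2)
        moreover have "column c (?X i) \<in> ?S" for c
          using 1 by (intro column_in_vertical_space) (simp add: km)
        ultimately show ?thesis
          by (auto simp: columns_def column_scaleR simp del: scaleR_minus_left
              intro!: subspace_scale[OF subspace_vertical_space])
      next
        case 2
        then have "(D t - mat 1) ** ?X i = (- 2 / (real m + 1)) *\<^sub>R (F t ** ?X (Suc m))"
          by (simp add: matrix_diff_mult D_top)
        then show ?thesis
          using fundamental_endomorphism_in_vertical_space[OF inv]
          by (auto simp: columns_def column_scaleR column_matrix_mult F_def
              simp del: scaleR_minus_left intro!: subspace_scale[OF subspace_vertical_space])
      qed
    qed
    then have *: "(- 1 / 2) *\<^sub>R ((D t - mat 1) *v x) \<in> ?S" for x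
      by (rule subspace_scale[OF subspace_vertical_space])
    show "eigenspace (D t) (-1) \<subseteq> ?S"
    proof
      fix x assume "x \<in> eigenspace (D t) (-1)"
      then have "(D t - mat 1) *v x = (- 2) *\<^sub>R x"
        by (simp add: eigenspace_def matrix_vector_mult_diff_rdistrib scaleR_2)
      with *[of x] show "x \<in> ?S"
        by simp
    qed
  next
    have "column c (?X i) \<in> eigenspace (D t) (-1)" if "i \<le> CARD('k) - 2" for i c
    proof -
      have "D t *v column c (?X i) = column c (- ?X i)"
        using that km by (simp add: D_low flip: column_matrix_mult)
      then show ?thesis
        by (simp add: eigenspace_def column_def vec_eq_iff)
    qed
    then show "?S \<subseteq> eigenspace (D t) (-1)"
      unfolding vertical_space_def
      by (intro span_minimal subspace_eigenspace) (auto simp: columns_def)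
  qed
  moreover have "F differentiable (at t)"
    unfolding F_def using \<open>open I\<close> A t by (rule fundamental_endomorphism_differentiable)
  ultimately show ?thesis
    by blast
qed

end
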